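(* Let $(r_n)_{n\in\mathbb{N}}$ be a sequence of positive real numbers such that $r_n\to\infty$ as $n\to\infty$ and such that, for some constant $c>0$, $r_{n+1}\le e^{r_n}+c$ for all $n$. Then there exist an escaping parameter $\lambda\in\mathbb{C}\setminus\{0\}$ and some $n_0\in\mathbb{N}$ such that $$|\operatorname{Re} f_\lambda^n(0)-r_n|\le \pi\qquad\text{for all } n\ge n_0,$$ where $f_\lambda(z)=\lambda e^z$.
   Context: For $\lambda\in\mathbb{C}\setminus\{0\}$ the exponential map $f_\lambda:\mathbb{C}\to\mathbb{C}$ is $f_\lambda(z)=\lambda e^z$, and $f_\lambda^n$ denotes its $n$-th iterate. The parameter $\lambda$ is called escaping if $f_\lambda^n(0)\to\infty$ (i.e. $|f_\lambda^n(0)|\to\infty$) as $n\to\infty$. *)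

theory Defs
  imports Complex_Main
begin

definition exp_map :: "complex \<Rightarrow> complex \<Rightarrow> complex" where
  "exp_map l z = l * exp z"

definition escaping :: "complex \<Rightarrow> bool" where
  "escaping l \<longleftrightarrow> l \<noteq> 0 \<and> filterlim (\<lambda>n. (exp_map l ^^ n) 0) at_infinity sequentially"

end

(* Replacing r n by max R (r n) for a large constant R does not affect the tail of r, so assume
   r n >= R throughout.  Choose centres c n with Re (c n) = r (n+1), c 0 real, and
   |c (n+1)| = c 0 * exp (Re (c n)).  For l in the disc of radius 4 around c 0, the function
   w |-> Ln w - Ln l + 2 pi i k, with a suitable integer k depending only on n, is an inverse
   branch of exp_map l that maps the disc of radius 4 around c (n+1) into the one around c n:
   its real part is almost constant, and k adjusts the imaginary part up to pi < 4.
   Composing N branches gives a continuous self-map of the first disc, and a Brouwer fixed point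
   of it is a parameter whose orbit follows N discs.  A limit point of these parameters follows
   all discs. *)

theory Submission
  imports Defs "HOL-Analysis.Analysis"
begin

text \<open>The disc lies in the half-plane where real parts are at least 24 - 4 = 20. There
  \<open>Ln\<close> is holomorphic with derivative at most 1/20 in modulus, so moving by 4 changes
  it by at most 4/20.\<close>

lemma norm_Ln_diff_le:
  assumes c: "24 \<le> Re c" and w: "w \<in> cball c 4"
  shows "norm (Ln w - Ln c) \<le> 1/5"
proof -
  have Re_ge: "20 \<le> Re x" if "x \<in> cball c 4" for x
    using abs_Re_le_cmod [of "c - x"] that c by (simp add: dist_norm)
  have "norm (Ln w - Ln c) \<le> (1/20) * norm (w - c)"
  proof (rule field_differentiable_bound [where S = "cball c 4"])
    fix x assume x: "x \<in> cball c 4"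
    then have "x \<notin> \<real>\<^sub>\<le>\<^sub>0"
      using Re_ge [OF x] by (auto simp: complex_nonpos_Reals_iff)
    then show "(Ln has_field_derivative inverse x) (at x within cball c 4)"
      by (simp add: has_field_derivative_Ln has_field_derivative_at_within)
    have "20 \<le> norm x"
      using Re_ge [OF x] complex_Re_le_cmod [of x] by linarith
    then show "norm (inverse x) \<le> 1/20"
      using le_imp_inverse_le [of 20 "norm x"] by (simp add: norm_inverse)
  qed (use w in auto)
  also have "\<dots> \<le> 1/5"
    using w by (simp add: dist_norm norm_minus_commute)
  finally show ?thesis .
qed

lemma exists_int_shift_pi: "\<exists>k::int. \<bar>t + 2 * pi * of_int k\<bar> \<le> pi"
proof -
  have "\<bar>of_int (round (t / (2*pi))) - t / (2*pi)\<bar> \<le> 1/2"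
    by (rule of_int_round_abs_le)
  then have "2 * pi * \<bar>of_int (round (t / (2*pi))) - t / (2*pi)\<bar> \<le> 2 * pi * (1/2)"
    by (rule mult_left_mono) simp
  moreover have "2 * pi * \<bar>of_int (round (t / (2*pi))) - t / (2*pi)\<bar>
      = \<bar>2 * pi * of_int (round (t / (2*pi))) - t\<bar>"
    by (simp add: abs_mult_pos' algebra_simps)
  ultimately have "\<bar>t + 2 * pi * of_int (- round (t / (2*pi)))\<bar> \<le> pi"
    unfolding of_int_minus by linarith
  then show ?thesis ..
qed

lemma exp_map_inverse_branch:
  fixes a :: real and b c :: complex
  assumes a: "24 \<le> a" and c: "24 \<le> Re c" and cmod_c: "cmod c = a * exp (Re b)"
  obtains \<psi> where
    "continuous_on (cball (of_real a) 4 \<times> cball c 4) (\<lambda>(l, w). \<psi> l w)"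
    "\<And>l w. \<lbrakk>l \<in> cball (of_real a) 4; w \<in> cball c 4\<rbrakk> \<Longrightarrow> \<psi> l w \<in> cball b 4"
    "\<And>l w. \<lbrakk>l \<in> cball (of_real a) 4; w \<in> cball c 4\<rbrakk> \<Longrightarrow> exp_map l (\<psi> l w) = w"
proof -
  \<comment> \<open>The integer \<open>k\<close> is computed from the centres only, so a single
    branch, jointly continuous in \<open>l\<close> and \<open>w\<close>, serves both discs.
    \<open>Ln\<close> of the positive real \<open>a\<close> contributes nothing to the imaginary
    part.\<close>
  obtain k :: int where k: "\<bar>(Im (Ln c) - Im b) + 2 * pi * of_int k\<bar> \<le> pi"
    using exists_int_shift_pi by blast
  define \<psi> where "\<psi> = (\<lambda>l w. Ln w - Ln l + complex_of_real (2 * pi * of_int k) * \<i>)"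
  have Re_pos: "0 < Re z" if "z \<in> cball d 4" "24 \<le> Re d" for z d
    using abs_Re_le_cmod [of "d - z"] that by (simp add: dist_norm)
  show ?thesis
  proof
    have "l \<notin> \<real>\<^sub>\<le>\<^sub>0" if "l \<in> cball (of_real a) 4" for l :: complex
      using Re_pos [OF that] a by (auto simp: complex_nonpos_Reals_iff)
    moreover have "w \<notin> \<real>\<^sub>\<le>\<^sub>0" if "w \<in> cball c 4" for w
      using Re_pos [OF that] c by (auto simp: complex_nonpos_Reals_iff)
    ultimately show "continuous_on (cball (of_real a) 4 \<times> cball c 4) (\<lambda>(l, w). \<psi> l w)"
      unfolding \<psi>_def split_beta by (intro continuous_intros) auto
  next
    fix l w :: complex
    assume l: "l \<in> cball (of_real a) 4" and w: "w \<in> cball c 4"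
    let ?z0 = "\<psi> (of_real a) c"
    have "c \<noteq> 0"
      using c by auto
    \<comment> \<open>This is where the modulus of \<open>c\<close> enters: ln |c| - ln a = Re b. So
      the image of the centre can miss \<open>b\<close> only in the imaginary direction.\<close>
    then have "Re ?z0 = Re b"
      using a cmod_c by (simp add: \<psi>_def Ln_of_real ln_mult)
    moreover have "\<bar>Im ?z0 - Im b\<bar> \<le> pi"
      using k a by (simp add: \<psi>_def Ln_of_real algebra_simps)
    ultimately have "norm (?z0 - b) \<le> pi"
      by (simp add: cmod_def)
    moreover have "norm (\<psi> l w - ?z0) \<le> norm (Ln w - Ln c) + norm (Ln l - Ln (of_real a))"
      using norm_triangle_ineq4 [of "Ln w - Ln c" "Ln l - Ln (of_real a)"]
      by (simp add: \<psi>_def algebra_simps)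
    moreover have "norm (Ln w - Ln c) \<le> 1/5" "norm (Ln l - Ln (of_real a)) \<le> 1/5"
      using norm_Ln_diff_le [OF c w] norm_Ln_diff_le [OF _ l] a by auto
    \<comment> \<open>The radius 4 is large enough because pi + 1/5 + 1/5 < 4.\<close>
    ultimately have "norm (\<psi> l w - b) \<le> 4"
      using norm_triangle_ineq [of "\<psi> l w - ?z0" "?z0 - b"] pi_approx by simp
    then show "\<psi> l w \<in> cball b 4"
      by (simp add: dist_norm norm_minus_commute)
    have "l \<noteq> 0" "w \<noteq> 0"
      using Re_pos [OF l] Re_pos [OF w] a c by auto
    moreover have "exp (complex_of_real (2 * pi * of_int k) * \<i>) = 1"
      using exp_integer_2pi [of "of_int k"] by (simp add: mult_ac)
    ultimately show "exp_map l (\<psi> l w) = w"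
      by (simp add: exp_map_def \<psi>_def exp_add exp_diff)
  qed
qed

text \<open>The starting point \<open>h l\<close> is obtained by pulling the centre of the last disc
  back through \<open>N\<close> branches, so it depends continuously on the parameter. The offset
  \<open>m\<close> is arbitrary because the induction adds a disc at the front.\<close>

lemma exp_map_orbit_through_discs_finite:
  fixes c :: "nat \<Rightarrow> complex" and e :: real
  assumes e: "0 \<le> e"
    and cont: "\<And>n. continuous_on (cball (c 0) e \<times> cball (c (Suc n)) e) (\<lambda>(l, w). \<psi> n l w)"
    and maps: "\<And>n l w. \<lbrakk>l \<in> cball (c 0) e; w \<in> cball (c (Suc n)) e\<rbrakk> \<Longrightarrow> \<psi> n l w \<in> cball (c n) e"
    and branch: "\<And>n l w. \<lbrakk>l \<in> cball (c 0) e; w \<in> cball (c (Suc n)) e\<rbrakk> \<Longrightarrow> exp_map l (\<psi> n l w) = w"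
  shows "\<exists>h. continuous_on (cball (c 0) e) h \<and>
           (\<forall>l\<in>cball (c 0) e. \<forall>j\<le>N. (exp_map l ^^ j) (h l) \<in> cball (c (m + j)) e)"
proof (induction N arbitrary: m)
  case 0
  show ?case
    using e by (intro exI [of _ "\<lambda>_. c m"]) auto
next
  case (Suc N)
  obtain h where h: "continuous_on (cball (c 0) e) h"
    and orbit: "\<And>l j. \<lbrakk>l \<in> cball (c 0) e; j \<le> N\<rbrakk>
                  \<Longrightarrow> (exp_map l ^^ j) (h l) \<in> cball (c (Suc m + j)) e"
    using Suc.IH [of "Suc m"] by blast
  have h_in: "h l \<in> cball (c (Suc m)) e" if "l \<in> cball (c 0) e" for l
    using orbit [OF that, of 0] by simp
  have "continuous_on (cball (c 0) e) (\<lambda>l. \<psi> m l (h l))"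
    using continuous_on_compose2 [OF cont [of m], of "cball (c 0) e" "\<lambda>l. (l, h l)"] h h_in
    by (fastforce intro!: continuous_intros)
  moreover have "(exp_map l ^^ j) (\<psi> m l (h l)) \<in> cball (c (m + j)) e"
    if l: "l \<in> cball (c 0) e" and j: "j \<le> Suc N" for l j
  proof (cases j)
    case 0
    then show ?thesis
      using maps [OF l h_in [OF l]] by simp
  next
    case (Suc i)
    \<comment> \<open>The first iterate undoes the newly added branch.\<close>
    have "(exp_map l ^^ j) (\<psi> m l (h l)) = (exp_map l ^^ i) (h l)"
      by (simp add: Suc funpow_swap1 branch [OF l h_in [OF l]] del: funpow.simps(2)
          add: funpow_Suc_right)
    then show ?thesis
      using orbit [OF l, of i] j Suc by simp
  qed
  ultimately show ?case
    by blast
qed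

text \<open>The orbit of 0 passes through \<open>l\<close> at time 1, so the starting point has to
  equal the parameter. Since both range over the disc around \<open>c 0\<close>, this is a fixed
  point equation for \<open>h\<close>.\<close>

lemma exp_map_orbit_through_discs:
  fixes c :: "nat \<Rightarrow> complex" and e :: real
  assumes e: "0 < e"
    and cont: "\<And>n. continuous_on (cball (c 0) e \<times> cball (c (Suc n)) e) (\<lambda>(l, w). \<psi> n l w)"
    and maps: "\<And>n l w. \<lbrakk>l \<in> cball (c 0) e; w \<in> cball (c (Suc n)) e\<rbrakk> \<Longrightarrow> \<psi> n l w \<in> cball (c n) e"
    and branch: "\<And>n l w. \<lbrakk>l \<in> cball (c 0) e; w \<in> cball (c (Suc n)) e\<rbrakk> \<Longrightarrow> exp_map l (\<psi> n l w) = w"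
  obtains l where "\<And>n. (exp_map l ^^ n) l \<in> cball (c n) e"
proof -
  have "\<exists>l\<in>cball (c 0) e. \<forall>j\<le>N. (exp_map l ^^ j) l \<in> cball (c j) e" for N
  proof -
    obtain h where h: "continuous_on (cball (c 0) e) h"
      and orbit: "\<And>l j. \<lbrakk>l \<in> cball (c 0) e; j \<le> N\<rbrakk>
                    \<Longrightarrow> (exp_map l ^^ j) (h l) \<in> cball (c j) e"
      using exp_map_orbit_through_discs_finite [of e c \<psi> N 0, OF less_imp_le [OF e] cont maps branch]
      by (auto simp: Ball_def)
    have "h \<in> cball (c 0) e \<rightarrow> cball (c 0) e"
      using orbit [of _ 0] by auto
    then obtain l where "l \<in> cball (c 0) e" "h l = l"
      using brouwer_ball [OF e h] by blast
    then show ?thesis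
      using orbit [of l] by (metis (no_types))
  qed
  then obtain L where L: "\<And>N. L N \<in> cball (c 0) e"
    and orbit: "\<And>N j. j \<le> N \<Longrightarrow> (exp_map (L N) ^^ j) (L N) \<in> cball (c j) e"
    by metis
  obtain l \<sigma> where \<sigma>: "strict_mono \<sigma>" and lim: "(L \<circ> \<sigma>) \<longlonglongrightarrow> l"
    using compact_imp_seq_compact [OF compact_cball, of "c 0" e] L
    unfolding seq_compact_def by metis
  \<comment> \<open>Each fixed iterate is continuous in the parameter and the starting point
    together, and here both converge to \<open>l\<close>.\<close>
  have tendsto: "(\<lambda>i. (exp_map (L (\<sigma> i)) ^^ j) (L (\<sigma> i))) \<longlonglongrightarrow> (exp_map l ^^ j) l" for j
    using lim by (induction j) (auto simp: o_def exp_map_def intro!: tendsto_intros)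
  show ?thesis
  proof
    fix n
    \<comment> \<open>For fixed \<open>n\<close>, all but finitely many parameters of the
      subsequence satisfy the \<open>n\<close>-th constraint, since i \<le> \<sigma> i. The
      constraint is closed and so survives in the limit.\<close>
    have "(exp_map (L (\<sigma> i)) ^^ n) (L (\<sigma> i)) \<in> cball (c n) e" if "n \<le> i" for i
      using orbit [of n "\<sigma> i"] seq_suble [OF \<sigma>, of i] that by simp
    then show "(exp_map l ^^ n) l \<in> cball (c n) e"
      by (intro Lim_in_closed_set [OF closed_cball _ _ tendsto])
        (auto simp: eventually_sequentially)
  qed
qed

lemma exp_map_parameter_with_real_parts:
  fixes s :: "nat \<Rightarrow> real"
  assumes s_ge: "\<And>n. 24 \<le> s n"
    and s_Suc: "\<And>n. s (Suc n) \<le> s 0 * exp (s n)"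
  obtains l where "l \<noteq> 0" "\<And>n. \<bar>Re ((exp_map l ^^ n) l) - s n\<bar> \<le> 1"
proof -
  define a where "a = s 0"
  \<comment> \<open>The imaginary part gives \<open>c (Suc m)\<close> the modulus
    \<open>a * exp (s m)\<close>. The growth condition on \<open>s\<close> keeps the radicand
    nonnegative.\<close>
  define c where "c = (\<lambda>n. case n of 0 \<Rightarrow> complex_of_real a
    | Suc m \<Rightarrow> Complex (s (Suc m)) (sqrt ((a * exp (s m))\<^sup>2 - (s (Suc m))\<^sup>2)))"
  have a: "24 \<le> a" and a_pos: "0 < a"
    using s_ge [of 0] by (auto simp: a_def)
  have c0: "c 0 = of_real a"
    by (simp add: c_def)
  have Re_c: "Re (c n) = s n" for n
    by (cases n) (auto simp: c_def a_def)
  have cmod_c: "cmod (c (Suc n)) = a * exp (Re (c n))" for n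
  proof -
    have "(s (Suc n))\<^sup>2 \<le> (a * exp (s n))\<^sup>2"
      using s_Suc [of n] s_ge [of "Suc n"] by (intro power_mono) (auto simp: a_def)
    then show ?thesis
      using a_pos unfolding Re_c by (simp add: c_def cmod_def)
  qed
  have "\<exists>\<psi>. continuous_on (cball (c 0) 4 \<times> cball (c (Suc n)) 4) (\<lambda>(l, w). \<psi> l w) \<and>
      (\<forall>l\<in>cball (c 0) 4. \<forall>w\<in>cball (c (Suc n)) 4. \<psi> l w \<in> cball (c n) 4 \<and> exp_map l (\<psi> l w) = w)"
    for n
  proof -
    have "24 \<le> Re (c (Suc n))"
      using s_ge by (simp add: Re_c)
    from exp_map_inverse_branch [OF a this cmod_c] show ?thesis
      unfolding c0 by metis
  qed
  then obtain \<psi> where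
    cont: "\<And>n. continuous_on (cball (c 0) 4 \<times> cball (c (Suc n)) 4) (\<lambda>(l, w). \<psi> n l w)" and
    \<psi>: "\<And>n l w. \<lbrakk>l \<in> cball (c 0) 4; w \<in> cball (c (Suc n)) 4\<rbrakk>
          \<Longrightarrow> \<psi> n l w \<in> cball (c n) 4 \<and> exp_map l (\<psi> n l w) = w"
    by metis
  obtain l where orbit: "\<And>n. (exp_map l ^^ n) l \<in> cball (c n) 4"
    using exp_map_orbit_through_discs [of 4 c \<psi>] cont \<psi> by auto
  have l: "l \<in> cball (c 0) 4"
    using orbit [of 0] by simp
  have "l \<noteq> 0"
    using l a by (auto simp: c0 dist_norm)
  \<comment> \<open>Membership in the disc gives only the bound 4, which exceeds pi. Looking one
    step ahead improves it: Re ?z = ln |?w| - ln |l| and s n = ln |c (Suc n)| - ln |c 0|, and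
    corresponding logarithms differ by at most 1/5.\<close>
  moreover have "\<bar>Re ((exp_map l ^^ n) l) - s n\<bar> \<le> 1" for n
  proof -
    let ?z = "(exp_map l ^^ n) l" and ?w = "(exp_map l ^^ Suc n) l"
    have w_eq: "?w = l * exp ?z"
      by (simp add: exp_map_def)
    have w0: "?w \<noteq> 0"
      using \<open>l \<noteq> 0\<close> unfolding w_eq by simp
    have c1: "24 \<le> Re (c (Suc n))" "c (Suc n) \<noteq> 0"
      using s_ge [of "Suc n"] Re_c [of "Suc n"] by auto
    have "\<bar>Re (Ln ?w - Ln (c (Suc n)))\<bar> \<le> 1/5"
      using abs_Re_le_cmod norm_Ln_diff_le [OF c1(1) orbit] by (rule order_trans)
    moreover have "\<bar>Re (Ln l - Ln (c 0))\<bar> \<le> 1/5"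
      using abs_Re_le_cmod norm_Ln_diff_le [OF _ l] s_ge Re_c by (metis order_trans)
    moreover have "Re (Ln ?w) = Re (Ln l) + Re ?z"
      using w0 \<open>l \<noteq> 0\<close> unfolding w_eq by (simp add: norm_mult ln_mult)
    moreover have "Re (Ln (c (Suc n))) = Re (Ln (c 0)) + s n"
      using c1 a_pos cmod_c [of n] by (simp add: c0 Re_c ln_mult)
    ultimately show ?thesis
      unfolding minus_complex.sel by linarith
  qed
  ultimately show ?thesis
    using that by blast
qed

theorem theorem3:
  fixes r :: "nat \<Rightarrow> real"
  assumes "\<And>n. r n > 0"
    and "filterlim r at_top sequentially"
    and "\<exists>c>0. \<forall>n. r (Suc n) \<le> exp (r n) + c"
  shows "\<exists>l :: complex. l \<noteq> 0 \<and> escaping l \<and>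
           (\<exists>n0 :: nat. \<forall>n\<ge>n0. \<bar>Re ((exp_map l ^^ n) 0) - r n\<bar> \<le> pi)"
proof -
  obtain c where c: "c > 0" and r_Suc: "\<And>n. r (Suc n) \<le> exp (r n) + c"
    using assms(3) by blast
  \<comment> \<open>The 24 keeps the discs far to the right, and the summand \<open>c\<close> makes
    \<open>s 0\<close> at least 1 + c, which absorbs the additive constant in the growth condition.
    The shift to \<open>r (Suc n)\<close> reflects that the orbit of \<open>l\<close> runs one step
    ahead of that of 0.\<close>
  define R where "R = 24 + c"
  define s where "s = (\<lambda>n. max R (r (Suc n)))"
  have s_ge: "R \<le> s n" for n
    by (simp add: s_def)
  have "s (Suc n) \<le> s 0 * exp (s n)" for n
  proof -
    have exp_s: "1 + s n \<le> exp (s n)"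
      by (rule exp_ge_add_one_self)
    have "r (Suc (Suc n)) \<le> exp (s n) + c"
      using r_Suc [of "Suc n"] by (rule order_trans) (simp add: s_def)
    moreover have "R \<le> exp (s n) + c"
      using exp_s s_ge [of n] c by linarith
    ultimately have "s (Suc n) \<le> exp (s n) + c"
      by (simp add: s_def)
    also have "\<dots> \<le> exp (s n) + c * exp (s n)"
      using c exp_s s_ge [of n] by (simp add: R_def)
    also have "\<dots> = (1 + c) * exp (s n)"
      by (simp add: algebra_simps)
    also have "\<dots> \<le> s 0 * exp (s n)"
      using s_ge [of 0] by (intro mult_right_mono) (auto simp: R_def)
    finally show ?thesis .
  qed
  moreover have "24 \<le> s n" for n
    using s_ge [of n] c by (simp add: R_def)
  ultimately obtain l where l: "l \<noteq> 0" and
    orbit: "\<And>n. \<bar>Re ((exp_map l ^^ n) l) - s n\<bar> \<le> 1"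
    using exp_map_parameter_with_real_parts by metis
  have orbit_Suc: "(exp_map l ^^ Suc n) 0 = (exp_map l ^^ n) l" for n
    by (simp add: funpow_Suc_right exp_map_def del: funpow.simps(2))
  obtain N where N: "\<And>n. N \<le> n \<Longrightarrow> R \<le> r n"
    using assms(2) by (auto simp: filterlim_at_top eventually_sequentially)
  have close: "\<bar>Re ((exp_map l ^^ n) 0) - r n\<bar> \<le> 1" if n: "Suc N \<le> n" for n
  proof -
    obtain m where m: "n = Suc m"
      using n by (cases n) auto
    \<comment> \<open>Beyond \<open>N\<close> the truncation at \<open>R\<close> has no
      effect.\<close>
    have "s m = r n"
      using N [of n] n m by (simp add: s_def)
    then show ?thesis
      using orbit [of m] orbit_Suc [of m] m by metis
  qed
  \<comment> \<open>The orbit escapes because its real parts stay within 1 of a sequence tending to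
    infinity.\<close>
  have "filterlim (\<lambda>n. norm ((exp_map l ^^ n) 0)) at_top sequentially"
  proof (rule filterlim_at_top_mono)
    show "filterlim (\<lambda>n. -1 + r n) at_top sequentially"
      by (rule filterlim_tendsto_add_at_top [OF tendsto_const assms(2)])
    show "\<forall>\<^sub>F n in sequentially. -1 + r n \<le> norm ((exp_map l ^^ n) 0)"
      unfolding eventually_sequentially
    proof (intro exI allI impI)
      fix n assume "Suc N \<le> n"
      from close [OF this] show "-1 + r n \<le> norm ((exp_map l ^^ n) 0)"
        using complex_Re_le_cmod [of "(exp_map l ^^ n) 0"] by linarith
    qed
  qed
  then have "escaping l"
    using l by (simp add: escaping_def filterlim_norm_at_top_imp_at_infinity)
  moreover have "\<forall>n\<ge>Suc N. \<bar>Re ((exp_map l ^^ n) 0) - r n\<bar> \<le> pi"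
    using close pi_gt3 by fastforce
  ultimately show ?thesis
    using l by blast
qed

end
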